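(* Let $(G,w_e)$ be a connected edge-weighted graph with $w_e:E(G)\to[0,\infty)$, let $c\in V(G)$, let $C=[c]_R=\{c_1,\ldots,c_k\}$ and $N(c)=\{n_1,\ldots,n_s\}$. Let $G'=G\setminus(C\setminus\{c\})$ (delete the vertices of $C$ other than $c$), and define $w_e':E(G')\to[0,\infty)$ by $w_e'(cn_j)=\sum_{i=1}^k w_e(c_in_j)$ for $j\in\{1,\ldots,s\}$ and $w_e'(e)=w_e(e)$ for every $e\in E(G)\setminus I(C)$. Then $$\widehat{W}_e(G,w_e)=\widehat{W}_e(G',w_e')+\frac12\sum_{c_in_j\in I(C)}\ \sum_{e\in I(C)_{ij}}w_e(c_in_j)w_e(e).$$ Moreover, if $w_e(e)=a$ for all $e\in I(C)$, where $a\in[0,\infty)$, then $$\widehat{W}_e(G,w_e)=\widehat{W}_e(G',w_e')+\frac{a^2ks}{2}(k-1)(s-1).$$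
   Context: All graphs are finite and simple; $N(v)$ is the set of neighbours of $v$, and $d_G(u,v)$ is the shortest-path distance. For edges $e=xy$, $f=ab$, $d_G(e,f)=\min\{d_G(x,a),d_G(x,b),d_G(y,a),d_G(y,b)\}$, and $\widehat{W}_e(G,w_e)=\frac12\sum_{e\in E(G)}\sum_{f\in E(G)}w_e(e)w_e(f)d_G(e,f)$. Vertices $u,v$ are in relation $R$ if $N(u)=N(v)$; this is an equivalence relation, and $[v]_R$ denotes the class of $v$. With $C$ and $N(c)$ as in the claim (all $c_i$ have neighbourhood $N(c)$), let $I(c_i)=\{c_in_j: j=1,\ldots,s\}$, $I(n_j)=\{c_in_j: i=1,\ldots,k\}$, $I(C)=\bigcup_i I(c_i)$ (the edges incident to a vertex of $C$), and for $i\in\{1,\ldots,k\}$, $j\in\{1,\ldots,s\}$, $I(C)_{ij}=I(C)\setminus(I(c_i)\cup I(n_j))$. *)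

theory Defs
  imports Complex_Main
begin

text \<open>
  A graph is a pair of a vertex set and a set of edges, an edge being the two-element set of its
  end vertices. Weights are total functions of which only the values on the edges are relevant.
\<close>

type_synonym 'a graph = "'a set \<times> 'a set set"

abbreviation verts :: "'a graph \<Rightarrow> 'a set" where "verts G \<equiv> fst G"
abbreviation edges :: "'a graph \<Rightarrow> 'a set set" where "edges G \<equiv> snd G"

definition simple_graph :: "'a graph \<Rightarrow> bool" where
  "simple_graph G \<longleftrightarrow> finite (verts G) \<and> (\<forall>e\<in>edges G. e \<subseteq> verts G \<and> card e = 2)"

definition nbrs :: "'a graph \<Rightarrow> 'a \<Rightarrow> 'a set" where
  "nbrs G v = {u \<in> verts G. {v, u} \<in> edges G}"

text \<open>Paths are nonempty lists of distinct vertices; their length counts edges.\<close>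

definition is_path :: "'a graph \<Rightarrow> 'a \<Rightarrow> 'a \<Rightarrow> 'a list \<Rightarrow> bool" where
  "is_path G u v p \<longleftrightarrow> p \<noteq> [] \<and> hd p = u \<and> last p = v \<and> set p \<subseteq> verts G \<and> distinct p \<and>
     (\<forall>i. Suc i < length p \<longrightarrow> {p ! i, p ! Suc i} \<in> edges G)"

definition connected_graph :: "'a graph \<Rightarrow> bool" where
  "connected_graph G \<longleftrightarrow> verts G \<noteq> {} \<and> (\<forall>u\<in>verts G. \<forall>v\<in>verts G. \<exists>p. is_path G u v p)"

text \<open>Only meaningful if some path joins the two vertices (the infimum of the empty set of
  naturals is not a distance).\<close>

definition gdist :: "'a graph \<Rightarrow> 'a \<Rightarrow> 'a \<Rightarrow> nat" where
  "gdist G u v = Inf {length p - 1 | p. is_path G u v p}"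

definition edist :: "'a graph \<Rightarrow> 'a set \<Rightarrow> 'a set \<Rightarrow> nat" where
  "edist G e f = Min {gdist G x a | x a. x \<in> e \<and> a \<in> f}"

definition edge_Wiener :: "'a graph \<Rightarrow> ('a set \<Rightarrow> real) \<Rightarrow> real" where
  "edge_Wiener G w = 1 / 2 * (\<Sum>e\<in>edges G. \<Sum>f\<in>edges G. w e * w f * real (edist G e f))"

definition R_rel :: "'a graph \<Rightarrow> ('a \<times> 'a) set" where
  "R_rel G = {(u, v). u \<in> verts G \<and> v \<in> verts G \<and> nbrs G u = nbrs G v}"

definition R_class :: "'a graph \<Rightarrow> 'a \<Rightarrow> 'a set" where
  "R_class G v = R_rel G `` {v}"

definition delete_verts :: "'a graph \<Rightarrow> 'a set \<Rightarrow> 'a graph" where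
  "delete_verts G S = (verts G - S, {e \<in> edges G. e \<inter> S = {}})"

text \<open>
  In the following, \<open>cv 1, \<dots>, cv k\<close> enumerate the class \<open>C\<close> and \<open>nv 1, \<dots>, nv s\<close> enumerate the
  common neighbourhood of its members. The four sets are, in this order,
  $I(c_i)$, $I(n_j)$, $I(C)$ and $I(C)_{ij}$.
\<close>

definition I_c :: "(nat \<Rightarrow> 'a) \<Rightarrow> (nat \<Rightarrow> 'a) \<Rightarrow> nat \<Rightarrow> nat \<Rightarrow> 'a set set" where
  "I_c cv nv s i = {{cv i, nv j} | j. j \<in> {1..s}}"

definition I_n :: "(nat \<Rightarrow> 'a) \<Rightarrow> (nat \<Rightarrow> 'a) \<Rightarrow> nat \<Rightarrow> nat \<Rightarrow> 'a set set" where
  "I_n cv nv k j = {{cv i, nv j} | i. i \<in> {1..k}}"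

definition I_C :: "(nat \<Rightarrow> 'a) \<Rightarrow> (nat \<Rightarrow> 'a) \<Rightarrow> nat \<Rightarrow> nat \<Rightarrow> 'a set set" where
  "I_C cv nv k s = (\<Union>i\<in>{1..k}. I_c cv nv s i)"

definition I_Cij :: "(nat \<Rightarrow> 'a) \<Rightarrow> (nat \<Rightarrow> 'a) \<Rightarrow> nat \<Rightarrow> nat \<Rightarrow> nat \<Rightarrow> nat \<Rightarrow> 'a set set" where
  "I_Cij cv nv k s i j = I_C cv nv k s - (I_c cv nv s i \<union> I_n cv nv k j)"

end

theory Submission
  imports Defs
begin

text \<open>
  Let \<open>r\<close> retract \<open>G\<close> onto \<open>G'\<close> by sending every vertex of \<open>C\<close> to \<open>c\<close>. The weight of an edge of
  \<open>G'\<close> is the total weight of its preimages under \<open>r\<close>, so the edge-Wiener index of \<open>G'\<close> is a sum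
  over pairs of edges of \<open>G\<close>, with the distance of \<open>e\<close> and \<open>f\<close> replaced by that of their images.
  Graph homomorphisms do not increase distances, and \<open>r\<close> has for every vertex \<open>y\<close> of \<open>C\<close> a
  homomorphic section that sends \<open>c\<close> to \<open>y\<close>. Hence \<open>r\<close> preserves the distance of two edges unless
  both meet \<open>C\<close>; in this case the images share \<open>c\<close>, while the original edges have distance \<open>1\<close> if
  they are disjoint, and \<open>0\<close> otherwise.
\<close>

section \<open>Distances as shortest walk lengths, and their behaviour under homomorphisms\<close>

definition adj :: "'a graph \<Rightarrow> ('a \<times> 'a) set" where
  "adj G = {(x, y). {x, y} \<in> edges G}"

lemma simple_graph_edgeD:
  assumes "simple_graph G" and "{x, y} \<in> edges G"
  shows "x \<in> verts G" and "y \<in> verts G" and "x \<noteq> y"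
  using assms unfolding simple_graph_def by fastforce+

lemma simple_graph_edgeE:
  assumes "simple_graph G" and "e \<in> edges G"
  obtains x y where "e = {x, y}"
  using assms unfolding simple_graph_def by (meson card_2_iff)

lemma finite_edges: "simple_graph G \<Longrightarrow> finite (edges G)"
  unfolding simple_graph_def by (meson Pow_iff finite_Pow_iff finite_subset subsetI)

lemma simple_graph_delete_verts: "simple_graph G \<Longrightarrow> simple_graph (delete_verts G S)"
  unfolding simple_graph_def delete_verts_def by auto

lemma path_relpow: "is_path G u v p \<Longrightarrow> (u, v) \<in> adj G ^^ (length p - 1)"
proof (induction p arbitrary: u)
  case Nil
  then show ?case by (simp add: is_path_def)
next
  case (Cons x p)
  show ?case
  proof (cases p)
    case Nil
    with Cons.prems show ?thesis by (auto simp: is_path_def)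
  next
    case (Cons y q)
    have "is_path G y v p"
      using Cons.prems \<open>p = y # q\<close> unfolding is_path_def by fastforce
    then have "(y, v) \<in> adj G ^^ (length p - 1)" by (rule Cons.IH)
    moreover have "(u, y) \<in> adj G"
      using Cons.prems \<open>p = y # q\<close> unfolding is_path_def adj_def by fastforce
    ultimately have "(u, v) \<in> adj G ^^ Suc (length p - 1)" by (rule relpow_Suc_I2[rotated])
    then show ?thesis by (simp add: \<open>p = y # q\<close>)
  qed
qed

lemma is_path_take:
  assumes "is_path G u v p" and "i < length p"
  shows "is_path G u (p ! i) (take (Suc i) p)"
  using assms unfolding is_path_def
  by (auto simp: last_conv_nth dest: in_set_takeD)

lemma is_path_snoc:
  assumes "is_path G u v p" and "{v, x} \<in> edges G" and "x \<in> verts G" and "x \<notin> set p"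
  shows "is_path G u x (p @ [x])"
  using assms unfolding is_path_def
  by (auto simp: nth_append last_conv_nth less_Suc_eq)
    (metis One_nat_def diff_Suc_1)

text \<open>A walk is pruned to a path vertex by vertex: a new vertex is appended to the path built
  so far, while a repeated one cuts that path back to its earlier occurrence. The length can only
  drop, hence the bound instead of an equality.\<close>

lemma relpow_path:
  assumes "simple_graph G" and "u \<in> verts G" and "(u, v) \<in> adj G ^^ n"
  shows "\<exists>p. is_path G u v p \<and> length p - 1 \<le> n"
  using assms(3)
proof (induction n arbitrary: v)
  case 0
  with assms(2) have "is_path G u v [u]" by (simp add: is_path_def)
  then show ?case by force
next
  case (Suc n)
  then obtain x where x: "(u, x) \<in> adj G ^^ n" and xv: "{x, v} \<in> edges G"
    by (auto simp: adj_def)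
  from Suc.IH[OF x] obtain p where p: "is_path G u x p" "length p - 1 \<le> n" by blast
  show ?case
  proof (cases "v \<in> set p")
    case True
    then obtain i where "i < length p" and "p ! i = v" by (auto simp: in_set_conv_nth)
    with is_path_take[OF p(1)] p(2) show ?thesis by fastforce
  next
    case False
    with is_path_snoc[OF p(1) xv] simple_graph_edgeD[OF assms(1) xv] p(2) show ?thesis
      by fastforce
  qed
qed

text \<open>Replaces paths by walks: the image of a path under a homomorphism may repeat vertices,
  but it is still a walk. Every path is a walk, and a shortest walk can be pruned to a path. If
  \<open>v\<close> cannot be reached, both sets are empty and the two infima agree
  trivially.\<close>

lemma gdist_relpow:
  assumes "simple_graph G" and "u \<in> verts G"
  shows "gdist G u v = Inf {n. (u, v) \<in> adj G ^^ n}"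
proof (cases "\<exists>n. (u, v) \<in> adj G ^^ n")
  case True
  let ?P = "{length p - 1 | p. is_path G u v p}" and ?Q = "{n. (u, v) \<in> adj G ^^ n}"
  have sub: "?P \<subseteq> ?Q" using path_relpow by fast
  have "Inf ?Q \<in> ?Q" using True by (intro Inf_nat_def1) blast
  then obtain p where "is_path G u v p" "length p - 1 \<le> Inf ?Q"
    using relpow_path[OF assms] by blast
  then have "?P \<noteq> {}" "Inf ?P \<le> Inf ?Q"
    by (auto intro!: cInf_lower2[of "length p - 1"])
  moreover from \<open>?P \<noteq> {}\<close> sub have "Inf ?Q \<le> Inf ?P"
    by (intro cInf_superset_mono) auto
  ultimately show ?thesis by (simp add: gdist_def)
next
  case False
  then have "{length p - 1 | p. is_path G u v p} = {n. (u, v) \<in> adj G ^^ n}"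
    using path_relpow by fast
  then show ?thesis by (simp add: gdist_def)
qed

lemma relpow_map:
  assumes "\<And>x y. (x, y) \<in> R \<Longrightarrow> (f x, f y) \<in> S" and "(u, v) \<in> R ^^ n"
  shows "(f u, f v) \<in> S ^^ n"
  using assms(2)
proof (induction n arbitrary: v)
  case (Suc n)
  then show ?case using assms(1) by (metis relpow_Suc_E relpow_Suc_I)
qed simp

text \<open>Walks of each length are carried forth by \<open>f\<close> and back by \<open>g\<close>.
  The map \<open>g\<close> has to undo \<open>f\<close> only at the two end vertices, because the
  inner vertices of a walk do not affect its length.\<close>

lemma gdist_hom_eq:
  assumes "simple_graph G" and "simple_graph H" and "u \<in> verts G" and "f u \<in> verts H"
    and f: "\<And>x y. (x, y) \<in> adj G \<Longrightarrow> (f x, f y) \<in> adj H"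
    and g: "\<And>x y. (x, y) \<in> adj H \<Longrightarrow> (g x, g y) \<in> adj G"
    and "g (f u) = u" and "g (f v) = v"
  shows "gdist G u v = gdist H (f u) (f v)"
proof -
  have "(u, v) \<in> adj G ^^ n \<longleftrightarrow> (f u, f v) \<in> adj H ^^ n" for n
    using relpow_map[of "adj G" f "adj H" u v n, OF f]
      relpow_map[of "adj H" g "adj G" "f u" "f v" n, OF g] assms(7,8) by auto
  then show ?thesis using assms(1-4) by (simp add: gdist_relpow)
qed

lemma gdist_refl: "u \<in> verts G \<Longrightarrow> gdist G u u = 0"
proof -
  assume "u \<in> verts G"
  then have "is_path G u u [u]" by (simp add: is_path_def)
  then have "0 \<in> {length p - 1 | p. is_path G u u p}" by force
  then show ?thesis unfolding gdist_def by (simp add: cInf_eq_minimum)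
qed

lemma gdist_edge:
  assumes "simple_graph G" and "{u, v} \<in> edges G"
  shows "gdist G u v \<le> 1"
proof -
  have "(u, v) \<in> adj G ^^ 1" using assms(2) by (simp add: adj_def)
  then show ?thesis
    using simple_graph_edgeD[OF assms] assms(1) by (auto simp: gdist_relpow intro!: cInf_lower)
qed

lemma gdist_pos:
  assumes "simple_graph G" and "connected_graph G" and "u \<in> verts G" and "v \<in> verts G" and "u \<noteq> v"
  shows "1 \<le> gdist G u v"
proof -
  let ?Q = "{n. (u, v) \<in> adj G ^^ n}"
  obtain p where "is_path G u v p" using assms unfolding connected_graph_def by blast
  \<comment> \<open>Connectedness matters here: the infimum of the empty set of naturals is
    \<open>0\<close>, so a positive distance requires some walk.\<close>
  then have "?Q \<noteq> {}" using path_relpow by fast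
  then have "Inf ?Q \<in> ?Q" by (rule Inf_nat_def1)
  with assms(5) have "Inf ?Q \<noteq> 0" by (metis mem_Collect_eq pair_in_Id_conv relpow.simps(1))
  then show ?thesis using assms by (simp add: gdist_relpow)
qed

section \<open>Bounds for the distance of two edges\<close>

lemma edist_image: "edist G e f = Min ((\<lambda>(x, a). gdist G x a) ` (e \<times> f))"
  unfolding edist_def by (rule arg_cong[where f = Min]) auto

lemma edist_le:
  assumes "finite e" and "finite f" and "x \<in> e" and "a \<in> f"
  shows "edist G e f \<le> gdist G x a"
  unfolding edist_image using assms by (intro Min_le) auto

lemma edist_ge:
  assumes "finite e" and "finite f" and "e \<noteq> {}" and "f \<noteq> {}"
    and "\<And>x a. x \<in> e \<Longrightarrow> a \<in> f \<Longrightarrow> m \<le> gdist G x a"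
  shows "m \<le> edist G e f"
  unfolding edist_image using assms by (subst Min_ge_iff) auto

section \<open>The class of \<open>c\<close>, the retraction onto \<open>G'\<close> and its
  sections\<close>

locale twin_class =
  fixes G :: "'a graph" and c :: 'a and cv nv :: "nat \<Rightarrow> 'a" and k s :: nat
  assumes simple: "simple_graph G" and conn: "connected_graph G" and c: "c \<in> verts G"
    and cv: "bij_betw cv {1..k} (R_class G c)"
    and nv: "bij_betw nv {1..s} (nbrs G c)"
begin

abbreviation C where "C \<equiv> R_class G c"
abbreviation G' where "G' \<equiv> delete_verts G (C - {c})"
abbreviation I where "I \<equiv> I_C cv nv k s"

definition retr :: "'a \<Rightarrow> 'a" where "retr v = (if v \<in> C then c else v)"
text \<open>For \<open>y\<close> in \<open>C\<close>, this embeds \<open>G'\<close> into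
  \<open>G\<close> with \<open>y\<close> in the role of \<open>c\<close>; following it by
  \<open>retr\<close> gives the identity on \<open>G'\<close>.\<close>

definition sect :: "'a \<Rightarrow> 'a \<Rightarrow> 'a" where "sect y v = (if v = c then y else v)"

lemma C_iff: "y \<in> C \<longleftrightarrow> y \<in> verts G \<and> nbrs G y = nbrs G c"
  using c by (auto simp: R_class_def R_rel_def)

lemma c_C: "c \<in> C"
  using c by (simp add: C_iff)

lemma edge_C:
  assumes "y \<in> C"
  shows "{y, x} \<in> edges G \<longleftrightarrow> x \<in> nbrs G c"
proof -
  have "{y, x} \<in> edges G \<longleftrightarrow> x \<in> nbrs G y"
    using simple_graph_edgeD[OF simple] by (auto simp: nbrs_def)
  then show ?thesis using assms by (simp add: C_iff)
qed

text \<open>A member of \<open>C\<close> adjacent to \<open>c\<close> would have the neighbourhood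
  of \<open>c\<close>, hence be adjacent to itself, and there are no loops.\<close>

lemma nbrs_disjoint_C: "x \<in> nbrs G c \<Longrightarrow> x \<notin> C"
  using edge_C simple_graph_edgeD(3)[OF simple] by blast

lemma simple': "simple_graph G'"
  using simple by (rule simple_graph_delete_verts)

lemma edges'_iff: "e \<in> edges G' \<longleftrightarrow> e \<in> edges G \<and> e \<inter> C \<subseteq> {c}"
  by (auto simp: delete_verts_def)

lemma retr_id: "x \<notin> C \<Longrightarrow> retr x = x"
  by (simp add: retr_def)

lemma retr_verts: "x \<in> verts G \<Longrightarrow> retr x \<in> verts G'"
  using c by (simp add: retr_def delete_verts_def)

lemma retr_edge:
  assumes "{x, y} \<in> edges G"
  shows "{retr x, retr y} \<in> edges G'"
proof -
  have "{retr x, retr y} \<in> edges G"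
  proof (cases "x \<in> C")
    case True
    \<comment> \<open>The other end is a neighbour of \<open>c\<close>, so it lies outside
      \<open>C\<close> and is fixed by \<open>retr\<close>.\<close>
    then have "y \<in> nbrs G c" using assms edge_C by blast
    then show ?thesis using True edge_C[OF c_C] nbrs_disjoint_C by (simp add: retr_def)
  next
    case False
    show ?thesis
    proof (cases "y \<in> C")
      case True
      then have "{c, x} \<in> edges G"
        using assms edge_C[of y x] edge_C[OF c_C, of x] by (simp add: insert_commute)
      then show ?thesis using True False by (simp add: retr_def insert_commute)
    qed (use assms False in \<open>simp add: retr_def\<close>)
  qed
  then show ?thesis by (auto simp: edges'_iff retr_def)
qed

lemma sect_edge:
  assumes "y \<in> C" and "{u, v} \<in> edges G'"
  shows "{sect y u, sect y v} \<in> edges G"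
proof -
  have uv: "{u, v} \<in> edges G" using assms(2) by (simp add: edges'_iff)
  \<comment> \<open>At most one end is \<open>c\<close>, so at most one end moves, and it moves to a
    vertex with the same neighbours.\<close>
  then have "u \<noteq> v" using simple_graph_edgeD[OF simple] by blast
  with uv show ?thesis
    using edge_C[OF c_C, of u] edge_C[OF c_C, of v] edge_C[OF assms(1), of u] edge_C[OF assms(1), of v]
    by (auto simp: sect_def insert_commute)
qed

lemma gdist_retr:
  assumes "u \<in> verts G" and "u \<notin> C \<or> v \<notin> C"
  shows "gdist G u v = gdist G' (retr u) (retr v)"
proof -
  \<comment> \<open>The end vertex in \<open>C\<close>, if there is one, is where the section must
    send \<open>c\<close>. If both ends lie outside \<open>C\<close>, every section fixes them and
    any member of \<open>C\<close> will do.\<close>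
  define y where "y = (if u \<in> C then u else if v \<in> C then v else c)"
  have y: "y \<in> C" using c_C by (auto simp: y_def)
  have "sect y (retr u) = u" "sect y (retr v) = v"
    using assms(2) c_C by (auto simp: y_def sect_def retr_def)
  moreover have "(retr a, retr b) \<in> adj G'" if "(a, b) \<in> adj G" for a b
    using that retr_edge by (simp add: adj_def)
  moreover have "(sect y a, sect y b) \<in> adj G" if "(a, b) \<in> adj G'" for a b
    using that sect_edge[OF y] by (simp add: adj_def)
  ultimately show ?thesis
    by (intro gdist_hom_eq[where g = "sect y"] simple simple' assms(1) retr_verts)
qed

text \<open>When one of the two edges avoids \<open>C\<close>, no pair of end vertices has both
  members in \<open>C\<close>, so \<open>gdist_retr\<close> applies to every pair over which the
  minimum is taken.\<close>

lemma edist_retr: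
  assumes "e \<subseteq> verts G" and "e \<inter> C = {} \<or> f \<inter> C = {}"
  shows "edist G e f = edist G' (retr ` e) (retr ` f)"
proof -
  have "gdist G x a = gdist G' (retr x) (retr a)" if "x \<in> e" "a \<in> f" for x a
    using that assms by (intro gdist_retr) auto
  then have "(\<lambda>(x, a). gdist G x a) ` (e \<times> f)
      = (\<lambda>(x, a). gdist G' x a) ` (retr ` e \<times> retr ` f)"
    by force
  then show ?thesis by (simp add: edist_image)
qed

section \<open>The edges meeting the class: enumeration and mutual distances\<close>

lemma cv_C: "i \<in> {1..k} \<Longrightarrow> cv i \<in> C"
  using cv by (auto simp: bij_betw_def)

lemma nv_nbrs: "j \<in> {1..s} \<Longrightarrow> nv j \<in> nbrs G c"
  using nv by (auto simp: bij_betw_def)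

lemma nv_notin_C: "j \<in> {1..s} \<Longrightarrow> nv j \<notin> C"
  using nv_nbrs nbrs_disjoint_C by blast

lemma edge_cv_nv: "i \<in> {1..k} \<Longrightarrow> j \<in> {1..s} \<Longrightarrow> {cv i, nv j} \<in> edges G"
  using edge_C cv_C nv_nbrs by blast

lemma cv_eq_iff: "i \<in> {1..k} \<Longrightarrow> p \<in> {1..k} \<Longrightarrow> cv i = cv p \<longleftrightarrow> i = p"
  by (rule inj_on_eq_iff[OF bij_betw_imp_inj_on[OF cv]])

lemma nv_eq_iff: "j \<in> {1..s} \<Longrightarrow> q \<in> {1..s} \<Longrightarrow> nv j = nv q \<longleftrightarrow> j = q"
  by (rule inj_on_eq_iff[OF bij_betw_imp_inj_on[OF nv]])

text \<open>Edges are unordered, but the crossed match of a \<open>cv\<close> with an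
  \<open>nv\<close> is impossible since the class and its neighbourhood are disjoint. Thus
  \<open>I\<close> is indexed without repetition by a \<open>k\<close> by \<open>s\<close>
  grid.\<close>

lemma cv_nv_edge_eq_iff:
  assumes "i \<in> {1..k}" "j \<in> {1..s}" "p \<in> {1..k}" "q \<in> {1..s}"
  shows "{cv i, nv j} = {cv p, nv q} \<longleftrightarrow> i = p \<and> j = q"
proof -
  have "cv i \<noteq> nv q" "cv p \<noteq> nv j" using assms cv_C nv_notin_C by metis+
  then show ?thesis using assms by (simp only: doubleton_eq_iff cv_eq_iff nv_eq_iff) blast
qed

lemma inj_cv_nv: "inj_on (\<lambda>(i, j). {cv i, nv j}) ({1..k} \<times> {1..s})"
  by (rule inj_onI) (clarify, metis cv_nv_edge_eq_iff)

lemma I_image: "I = (\<lambda>(i, j). {cv i, nv j}) ` ({1..k} \<times> {1..s})"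
proof -
  have "I = (\<Union>i\<in>{1..k}. (\<lambda>j. {cv i, nv j}) ` {1..s})"
    unfolding I_C_def I_c_def Setcompr_eq_image by simp
  also have "\<dots> = (\<lambda>(i, j). {cv i, nv j}) ` ({1..k} \<times> {1..s})"
    unfolding Sigma_def image_UN by (simp add: UNION_singleton_eq_range)
  finally show ?thesis .
qed

lemma I_I: "i \<in> {1..k} \<Longrightarrow> j \<in> {1..s} \<Longrightarrow> {cv i, nv j} \<in> I"
  unfolding I_image by (rule image_eqI[where x = "(i, j)"]) simp_all

lemma I_E:
  assumes "e \<in> I"
  obtains i j where "e = {cv i, nv j}" and "i \<in> {1..k}" and "j \<in> {1..s}"
  using assms unfolding I_image by (elim imageE SigmaE) simp

lemma I_subset: "I \<subseteq> edges G"
  by (rule subsetI, elim I_E) (simp only: edge_cv_nv)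

lemma sum_I: "sum h I = (\<Sum>i=1..k. \<Sum>j=1..s. h {cv i, nv j})"
  unfolding I_image sum.reindex[OF inj_cv_nv] sum.cartesian_product
  by (simp add: case_prod_unfold)

text \<open>Makes membership in the enumerated set \<open>I\<close> usable geometrically: an edge of
  \<open>G\<close> outside \<open>I\<close> avoids \<open>C\<close>.\<close>

lemma edge_meets_C:
  assumes "e \<in> edges G" and "e \<inter> C \<noteq> {}"
  shows "e \<in> I"
proof -
  obtain a b where ab: "e = {a, b}" using simple_graph_edgeE[OF simple assms(1)] by blast
  obtain y where "y \<in> e" and y: "y \<in> C" using assms(2) by blast
  with ab obtain x where e: "e = {y, x}" by (metis insertE insert_commute singletonD)
  have "x \<in> nbrs G c" using assms(1) e edge_C[OF y] by simp
  then obtain j where "j \<in> {1..s}" "x = nv j" using nv unfolding bij_betw_def by blast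
  moreover obtain i where "i \<in> {1..k}" "y = cv i" using y cv unfolding bij_betw_def by blast
  ultimately show ?thesis using e I_I by simp
qed

text \<open>In the grid of index pairs, \<open>I_c\<close> is the row of \<open>i\<close> and
  \<open>I_n\<close> the column of \<open>j\<close>; removing both leaves a smaller grid.\<close>

lemma I_Cij_image:
  assumes "i \<in> {1..k}" "j \<in> {1..s}"
  shows "I_Cij cv nv k s i j = (\<lambda>(p, q). {cv p, nv q}) ` (({1..k} - {i}) \<times> ({1..s} - {j}))"
proof -
  have "{cv p, nv q} \<in> I_c cv nv s i \<longleftrightarrow> p = i" if "p \<in> {1..k}" "q \<in> {1..s}" for p q
    using that assms cv_nv_edge_eq_iff[of p q i] by (auto simp: I_c_def simp del: atLeastAtMost_iff)
  moreover have "{cv p, nv q} \<in> I_n cv nv k j \<longleftrightarrow> q = j" if "p \<in> {1..k}" "q \<in> {1..s}" for p q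
    using that assms cv_nv_edge_eq_iff[of p q _ j] by (auto simp: I_n_def simp del: atLeastAtMost_iff)
  ultimately show ?thesis by (fastforce simp: I_Cij_def I_image simp del: atLeastAtMost_iff)
qed

lemma edist_I:
  assumes "i \<in> {1..k}" "j \<in> {1..s}" "f \<in> I"
  shows "edist G {cv i, nv j} f = (if f \<in> I_Cij cv nv k s i j then 1 else 0)"
proof -
  obtain p q where f: "f = {cv p, nv q}" and pq: "p \<in> {1..k}" "q \<in> {1..s}"
    using assms(3) by (rule I_E)
  have mem: "f \<in> I_Cij cv nv k s i j \<longleftrightarrow> p \<noteq> i \<and> q \<noteq> j"
    using inj_cv_nv assms(1,2) pq cv_nv_edge_eq_iff[OF pq]
    by (auto simp: I_Cij_image f image_iff simp del: atLeastAtMost_iff)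
  have v: "cv i \<in> verts G" "nv j \<in> verts G" "cv p \<in> verts G" "nv q \<in> verts G"
    using simple_graph_edgeD(1,2)[OF simple edge_cv_nv] assms(1,2) pq by blast+
  show ?thesis
  proof (cases "p = i \<or> q = j")
    case True
    then obtain x where "x \<in> {cv i, nv j}" "x \<in> f" "x \<in> verts G" using f v by auto
    then have "edist G {cv i, nv j} f \<le> 0"
      using edist_le[of "{cv i, nv j}" f x x G] gdist_refl[of x G] f by auto
    with True mem show ?thesis by auto
  next
    case False
    have ne: "cv i \<noteq> cv p" "nv j \<noteq> nv q"
      using False assms(1,2) pq by (simp_all only: cv_eq_iff nv_eq_iff) simp_all
    have ne': "cv i \<noteq> nv q" "cv p \<noteq> nv j" using assms(1,2) pq cv_C nv_notin_C by metis+
    have "1 \<le> gdist G x a" if "x \<in> {cv i, nv j}" "a \<in> f" for x a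
    proof (rule gdist_pos[OF simple conn])
      show "x \<in> verts G" "a \<in> verts G" using that v f by auto
      show "x \<noteq> a" using that f ne ne' by auto
    qed
    then have "1 \<le> edist G {cv i, nv j} f" by (intro edist_ge) (auto simp: f)
    \<comment> \<open>All members of the class have the same neighbours, so the first end of one
      edge is joined to the second end of the other.\<close>
    moreover have "edist G {cv i, nv j} f \<le> gdist G (cv i) (nv q)"
      by (intro edist_le) (auto simp: f)
    moreover have "gdist G (cv i) (nv q) \<le> 1"
      using gdist_edge[OF simple] edge_cv_nv assms(1) pq(2) by blast
    ultimately show ?thesis using False mem by auto
  qed
qed

lemma retr_I:
  assumes "i \<in> {1..k}" "j \<in> {1..s}"
  shows "retr ` {cv i, nv j} = {c, nv j}"
  using assms cv_C nv_notin_C by (simp add: retr_def insert_commute)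

lemma edist_retr_I:
  assumes "e \<in> I" "f \<in> I"
  shows "edist G' (retr ` e) (retr ` f) = 0"
proof -
  have "c \<in> retr ` e" "c \<in> retr ` f" "finite e" "finite f"
    using assms by (auto elim!: I_E simp: retr_I simp del: image_insert atLeastAtMost_iff)
  then have "edist G' (retr ` e) (retr ` f) \<le> gdist G' c c" by (intro edist_le) auto
  also have "\<dots> = 0" using c by (intro gdist_refl) (simp add: delete_verts_def)
  finally show ?thesis by simp
qed

section \<open>The weights of \<open>G'\<close> as sums over fibres of the retraction\<close>

lemma retr_edge_image:
  assumes "e \<in> edges G"
  shows "retr ` e \<in> edges G'"
proof -
  obtain x y where "e = {x, y}" using simple_graph_edgeE[OF simple assms] by blast
  then show ?thesis using retr_edge[of x y] assms by simp
qed

lemma retr_edge_id: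
  assumes "e \<in> edges G - I"
  shows "retr ` e = e"
proof -
  have "e \<inter> C = {}" using assms edge_meets_C by blast
  then have "retr x = x" if "x \<in> e" for x using that retr_id by blast
  then show ?thesis by force
qed

text \<open>An edge of \<open>G'\<close> avoiding \<open>C\<close> is its own only preimage. The
  preimages of \<open>{c, nv j}\<close> are the edges \<open>{cv p, nv j}\<close>, exactly those
  whose weights are added up in \<open>w'\<close>.\<close>

lemma retr_fibre:
  assumes w1: "\<forall>j\<in>{1..s}. w' {c, nv j} = (\<Sum>i=1..k. w {cv i, nv j})"
    and w2: "\<forall>e\<in>edges G - I. w' e = w e"
    and e': "e' \<in> edges G'"
  shows "w' e' = (\<Sum>e | e \<in> edges G \<and> retr ` e = e'. w e)"
proof (cases "e' \<inter> C = {}")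
  case True
  have "e' \<in> edges G" using e' by (simp add: edges'_iff)
  have "e' \<notin> I" using True cv_C by (blast elim: I_E)
  have "e = e'" if "e \<in> edges G" "retr ` e = e'" for e
  proof -
    have "e \<notin> I"
    proof
      assume "e \<in> I"
      then have "c \<in> retr ` e" by (elim I_E) (simp only: retr_I insertI1)
      then show False using that True c_C by blast
    qed
    then show ?thesis using that retr_edge_id by blast
  qed
  then have "{e. e \<in> edges G \<and> retr ` e = e'} = {e'}"
    using \<open>e' \<in> edges G\<close> \<open>e' \<notin> I\<close> retr_edge_id by blast
  then show ?thesis using w2 \<open>e' \<in> edges G\<close> \<open>e' \<notin> I\<close> by simp
next
  case False
  then have "e' \<in> I" using e' edge_meets_C by (simp add: edges'_iff)
  then obtain i j where ij: "i \<in> {1..k}" "j \<in> {1..s}" "e' = {cv i, nv j}" by (blast elim: I_E)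
  \<comment> \<open>The only vertex of \<open>C\<close> that survives in \<open>G'\<close> is
    \<open>c\<close>.\<close>
  have "cv i = c" using e' ij cv_C[of i] by (auto simp: edges'_iff)
  with ij have e'_eq: "e' = {c, nv j}" by simp
  have "{e. e \<in> edges G \<and> retr ` e = e'} = (\<lambda>p. {cv p, nv j}) ` {1..k}" (is "?F = ?S")
  proof
    show "?S \<subseteq> ?F" using ij(2) edge_cv_nv retr_I e'_eq by blast
    show "?F \<subseteq> ?S"
    proof
      fix e assume "e \<in> ?F"
      then have e: "e \<in> edges G" "retr ` e = e'" by auto
      \<comment> \<open>An edge outside \<open>I\<close> is its own image, so it would equal
        \<open>e'\<close>, which lies in \<open>I\<close>.\<close>
      have "e \<in> I" using e \<open>e' \<in> I\<close> retr_edge_id[of e] by fastforce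
      then obtain p q where pq: "p \<in> {1..k}" "q \<in> {1..s}" "e = {cv p, nv q}" by (blast elim: I_E)
      then have "{c, nv q} = {c, nv j}" using e(2) e'_eq retr_I by simp
      then have "nv q = nv j" by (metis doubleton_eq_iff)
      then show "e \<in> ?S" using pq by auto
    qed
  qed
  moreover have "inj_on (\<lambda>p. {cv p, nv j}) {1..k}"
    using cv_nv_edge_eq_iff ij(2) by (auto simp: inj_on_def)
  ultimately show ?thesis using w1 ij(2) e'_eq by (simp add: sum.reindex)
qed

text \<open>A change of variables along \<open>retr\<close>. With \<open>h\<close> arbitrary, it
  applies to the inner and then to the outer sum of the edge-Wiener index.\<close>

lemma sum_edges':
  fixes h :: "'a set \<Rightarrow> real"
  assumes "\<forall>j\<in>{1..s}. w' {c, nv j} = (\<Sum>i=1..k. w {cv i, nv j})"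
    and "\<forall>e\<in>edges G - I. w' e = w e"
  shows "(\<Sum>e\<in>edges G'. w' e * h e) = (\<Sum>e\<in>edges G. w e * h (retr ` e))"
proof -
  have "(\<Sum>e'\<in>edges G'. w' e' * h e')
      = (\<Sum>e'\<in>edges G'. \<Sum>e | e \<in> edges G \<and> retr ` e = e'. w e * h (retr ` e))"
    using retr_fibre[OF assms] by (intro sum.cong) (auto simp: sum_distrib_right)
  also have "\<dots> = (\<Sum>e\<in>edges G. w e * h (retr ` e))"
    using retr_edge_image by (intro sum.group finite_edges simple simple') auto
  finally show ?thesis .
qed

lemma edge_Wiener_retr:
  assumes "\<forall>j\<in>{1..s}. w' {c, nv j} = (\<Sum>i=1..k. w {cv i, nv j})"
    and "\<forall>e\<in>edges G - I. w' e = w e"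
  shows "edge_Wiener G' w'
    = 1 / 2 * (\<Sum>e\<in>edges G. \<Sum>f\<in>edges G. w e * w f * real (edist G' (retr ` e) (retr ` f)))"
proof -
  have "(\<Sum>e\<in>edges G'. \<Sum>f\<in>edges G'. w' e * w' f * real (edist G' e f))
      = (\<Sum>e\<in>edges G'. w' e * (\<Sum>f\<in>edges G'. w' f * real (edist G' e f)))"
    by (simp add: sum_distrib_left mult.assoc)
  also have "\<dots> = (\<Sum>e\<in>edges G. w e * (\<Sum>f\<in>edges G. w f * real (edist G' (retr ` e) (retr ` f))))"
    by (simp add: sum_edges'[OF assms])
  finally show ?thesis by (simp add: edge_Wiener_def sum_distrib_left mult.assoc)
qed

section \<open>Comparison of the two indices\<close>

lemma edge_Wiener_diff:
  assumes "\<forall>j\<in>{1..s}. w' {c, nv j} = (\<Sum>i=1..k. w {cv i, nv j})"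
    and "\<forall>e\<in>edges G - I. w' e = w e"
  shows "edge_Wiener G w = edge_Wiener G' w'
    + 1 / 2 * (\<Sum>i=1..k. \<Sum>j=1..s. \<Sum>e\<in>I_Cij cv nv k s i j. w {cv i, nv j} * w e)"
proof -
  let ?d = "\<lambda>e f. real (edist G e f)" and ?d' = "\<lambda>e f. real (edist G' (retr ` e) (retr ` f))"
  \<comment> \<open>The contribution of one ordered pair of edges to twice the difference of the
    indices.\<close>
  let ?t = "\<lambda>e f. w e * w f * (?d e f - ?d' e f)"
  have fin: "finite (edges G)" by (rule finite_edges[OF simple])
  \<comment> \<open>Such a pair contains an edge that avoids \<open>C\<close>, so the retraction
    preserves its distance; only pairs in \<open>I\<close> remain.\<close>
  have t0: "?t e f = 0" if "e \<in> edges G" "f \<in> edges G" "e \<notin> I \<or> f \<notin> I" for e f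
  proof -
    have "e \<subseteq> verts G" using that(1) simple by (auto simp: simple_graph_def)
    then have "edist G e f = edist G' (retr ` e) (retr ` f)"
      using that edge_meets_C by (intro edist_retr) auto
    then show ?thesis by simp
  qed
  have "(\<Sum>e\<in>edges G. \<Sum>f\<in>edges G. w e * w f * ?d e f)
      - (\<Sum>e\<in>edges G. \<Sum>f\<in>edges G. w e * w f * ?d' e f) = (\<Sum>e\<in>edges G. \<Sum>f\<in>edges G. ?t e f)"
    by (simp add: sum_subtractf right_diff_distrib)
  also have "\<dots> = (\<Sum>e\<in>edges G. \<Sum>f\<in>I. ?t e f)"
    using I_subset t0 by (intro sum.cong sum.mono_neutral_right fin) auto
  also have "\<dots> = (\<Sum>e\<in>I. \<Sum>f\<in>I. ?t e f)"
    using I_subset t0 by (intro sum.mono_neutral_right fin) (auto intro!: sum.neutral)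
  also have "\<dots> = (\<Sum>i=1..k. \<Sum>j=1..s. \<Sum>f\<in>I. ?t {cv i, nv j} f)"
    by (rule sum_I)
  also have "\<dots> = (\<Sum>i=1..k. \<Sum>j=1..s. \<Sum>e\<in>I_Cij cv nv k s i j. w {cv i, nv j} * w e)"
  proof (rule sum.cong[OF refl], rule sum.cong[OF refl])
    fix i j assume ij: "i \<in> {1..k}" "j \<in> {1..s}"
    then have "{cv i, nv j} \<in> I" by (rule I_I)
    then have "(\<Sum>f\<in>I. ?t {cv i, nv j} f)
        = (\<Sum>f\<in>I. if f \<in> I_Cij cv nv k s i j then w {cv i, nv j} * w f else 0)"
      \<comment> \<open>Within \<open>I\<close> the images have distance \<open>0\<close>, so the
        difference of distances is the indicator of \<open>I_Cij\<close>.\<close>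
      using edist_I[OF ij] edist_retr_I by (intro sum.cong refl) (simp del: image_insert)
    also have "\<dots> = (\<Sum>f\<in>I_Cij cv nv k s i j. w {cv i, nv j} * w f)"
      using finite_subset[OF I_subset fin]
      by (intro sum.mono_neutral_cong_right) (auto simp: I_Cij_def)
    finally show "(\<Sum>f\<in>I. ?t {cv i, nv j} f) = (\<Sum>e\<in>I_Cij cv nv k s i j. w {cv i, nv j} * w e)" .
  qed
  finally show ?thesis
    unfolding edge_Wiener_retr[OF assms] unfolding edge_Wiener_def by (simp add: field_simps)
qed

section \<open>Constant weight on the edges meeting the class\<close>

lemma card_I_Cij:
  assumes "i \<in> {1..k}" "j \<in> {1..s}"
  shows "card (I_Cij cv nv k s i j) = (k - 1) * (s - 1)"
proof -
  have "inj_on (\<lambda>(p, q). {cv p, nv q}) (({1..k} - {i}) \<times> ({1..s} - {j}))"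
    by (rule inj_on_subset[OF inj_cv_nv]) auto
  then show ?thesis
    using assms by (simp add: I_Cij_image card_image card_cartesian_product)
qed

lemma sum_I_Cij_const:
  fixes a :: real
  assumes "\<forall>e\<in>I. w e = a"
  shows "(\<Sum>i=1..k. \<Sum>j=1..s. \<Sum>e\<in>I_Cij cv nv k s i j. w {cv i, nv j} * w e)
    = a\<^sup>2 * real k * real s * (real k - 1) * (real s - 1)"
proof -
  have "(\<Sum>i=1..k. \<Sum>j=1..s. \<Sum>e\<in>I_Cij cv nv k s i j. w {cv i, nv j} * w e)
      = (\<Sum>i=1..k. \<Sum>j=1..s. (real k - 1) * (real s - 1) * a\<^sup>2)"
  proof (rule sum.cong[OF refl], rule sum.cong[OF refl])
    fix i j assume ij: "i \<in> {1..k}" "j \<in> {1..s}"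
    then have "w {cv i, nv j} = a" using assms I_I by blast
    then have "(\<Sum>e\<in>I_Cij cv nv k s i j. w {cv i, nv j} * w e) = (\<Sum>e\<in>I_Cij cv nv k s i j. a\<^sup>2)"
      using assms by (intro sum.cong) (auto simp: I_Cij_def power2_eq_square)
    also have "\<dots> = (real k - 1) * (real s - 1) * a\<^sup>2"
      \<comment> \<open>The indices \<open>i\<close> and \<open>j\<close> witness that
        \<open>k\<close> and \<open>s\<close> are at least \<open>1\<close>, so the natural
        subtractions in the cardinality are not truncated.\<close>
      using ij by (simp add: card_I_Cij of_nat_diff)
    finally show "(\<Sum>e\<in>I_Cij cv nv k s i j. w {cv i, nv j} * w e)
      = (real k - 1) * (real s - 1) * a\<^sup>2" .
  qed
  \<comment> \<open>For \<open>s = 0\<close> the sums over \<open>j\<close> are empty, in accordance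
    with the factor \<open>real s\<close>.\<close>
  then show ?thesis by simp
qed

end

theorem theorem4p2:
  fixes G G' :: "'a graph"
    and w w' :: "'a set \<Rightarrow> real"
    and c :: 'a
    and C :: "'a set"
    and cv nv :: "nat \<Rightarrow> 'a"
    and k s :: nat
  assumes "simple_graph G" and "connected_graph G"
    and "\<forall>e\<in>edges G. 0 \<le> w e"
    and "c \<in> verts G"
    and "C = R_class G c"
    and "bij_betw cv {1..k} C"
    and "bij_betw nv {1..s} (nbrs G c)"
    and "G' = delete_verts G (C - {c})"
    and "\<forall>j\<in>{1..s}. w' {c, nv j} = (\<Sum>i=1..k. w {cv i, nv j})"
    and "\<forall>e\<in>edges G - I_C cv nv k s. w' e = w e"
  shows "edge_Wiener G w = edge_Wiener G' w'
           + 1 / 2 * (\<Sum>i=1..k. \<Sum>j=1..s. \<Sum>e\<in>I_Cij cv nv k s i j. w {cv i, nv j} * w e)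
       \<and> (\<forall>a::real. 0 \<le> a \<and> (\<forall>e\<in>I_C cv nv k s. w e = a) \<longrightarrow>
           edge_Wiener G w = edge_Wiener G' w'
             + a\<^sup>2 * real k * real s / 2 * (real k - 1) * (real s - 1))"
proof -
  interpret twin_class G c cv nv k s
    using assms(1,2,4-7) by unfold_locales simp_all
  have diff: "edge_Wiener G w = edge_Wiener G' w'
      + 1 / 2 * (\<Sum>i=1..k. \<Sum>j=1..s. \<Sum>e\<in>I_Cij cv nv k s i j. w {cv i, nv j} * w e)"
    using edge_Wiener_diff assms(5,8-10) by simp
  moreover have "edge_Wiener G w = edge_Wiener G' w'
      + a\<^sup>2 * real k * real s / 2 * (real k - 1) * (real s - 1)"
    if "\<forall>e\<in>I_C cv nv k s. w e = a" for a
    using diff sum_I_Cij_const[OF that] by simp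
  ultimately show ?thesis by blast
qed

end
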